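(* Let $P\subset\mathbb{R}^d$ be a $d$-dimensional convex polytope (with the origin in its interior). Let $\dot P_1,\dots,\dot P_r$ be first-order motions of $P$ representing a basis of the first-order flex space $\ker\mathcal R(P)/\mathcal T_P$, and let $\boldsymbol\xi_1,\dots,\boldsymbol\xi_s$ be a basis of the space of equilibrium stresses of $P$. For $\lambda\in\mathbb{R}^r$, $\mu\in\mathbb{R}^s$ set $$E_{\dot P,\boldsymbol\xi}(\lambda,\mu)=\Big(\sum_{j=1}^s\mu_j\boldsymbol\xi_j\Big)^{\!\top}\mathcal R\Big(\sum_{i=1}^r\lambda_i\dot P_i\Big)\Big(\sum_{i=1}^r\lambda_i\dot P_i\Big)=\sum_{j=1}^s\mu_j\,Q_j(\lambda),$$ with quadratic forms $Q_1,\dots,Q_s\in\mathbb{R}[\lambda_1,\dots,\lambda_r]$. If the homogeneous polynomial system $\nabla_\mu E_{\dot P,\boldsymbol\xi}(\lambda)=(Q_1(\lambda),\dots,Q_s(\lambda))=0$ has only $\lambda_1=\dots=\lambda_r=0$ as a real solution, then every first-order flex of $P$ is blocked by some equilibrium stress. Conversely, any first-order flex of $P$ that is not blocked by any equilibrium stress corresponds to a non-trivial real zero of this system; that is, if its class in $\ker\mathcal R(P)/\mathcal T_P$ is that of $\sum_i\lambda_i\dot P_i$, then $\lambda\neq0$ and $Q_1(\lambda)=\dots=Q_s(\lambda)=0$.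
   Context: Let $P$ have vertex set $V$, edge set $E$ and facet set $F$; write $i\sim\sigma$ if vertex $i$ lies on facet $\sigma$, and let $V\!F$ be the set of incident vertex-facet pairs. $P$ is identified with the pair $(\boldsymbol p,\boldsymbol a)$ of maps $\boldsymbol p:V\to\mathbb{R}^d$ (vertices) and $\boldsymbol a:F\to\mathbb{R}^d$ (outward facet normals), scaled such that $\langle p_i,a_\sigma\rangle=1$ for $i\sim\sigma$ and $\langle p_i,a_\sigma\rangle<1$ for $i\not\sim\sigma$. Rigidity matrix: for any pair of maps $(\boldsymbol q,\boldsymbol b)$, $\boldsymbol q:V\to\mathbb{R}^d$, $\boldsymbol b:F\to\mathbb{R}^d$, $\mathcal R(\boldsymbol q,\boldsymbol b)$ is the $(|E|+|V\!F|)\times(d|V|+d|F|)$ matrix of the linear map sending $(\dot{\boldsymbol p},\dot{\boldsymbol a})\in\mathbb{R}^{dV}\oplus\mathbb{R}^{dF}$ to the vector with entries $\langle q_i-q_j,\dot p_i-\dot p_j\rangle$ for $ij\in E$ and $\langle q_i,\dot a_\sigma\rangle+\langle\dot p_i,b_\sigma\rangle$ for $i\sim\sigma$. Set $\mathcal R(P)=\mathcal R(\boldsymbol p,\boldsymbol a)$, and for $\dot P=(\dot{\boldsymbol p},\dot{\boldsymbol a})$ set $\mathcal R(\dot P)=\mathcal R(\dot{\boldsymbol p},\dot{\boldsymbol a})$. A first-order motion of $P$ is an element $\dot P=(\dot{\boldsymbol p},\dot{\boldsymbol a})$ of $\ker\mathcal R(P)$; it is trivial if $\langle p_i-p_j,\dot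 p_i-\dot p_j\rangle=0$ for all $i,j\in V$. The trivial ones form the linear subspace $\mathcal T_P\subseteq\ker\mathcal R(P)$, and $\ker\mathcal R(P)/\mathcal T_P$ is called the first-order flex space. A first-order flex is a non-trivial first-order motion. An equilibrium stress of $P$ is an element $\boldsymbol\xi\in\mathbb{R}^{E}\oplus\mathbb{R}^{V\!F}$ of $\ker\mathcal R(P)^\top$. A stress $\boldsymbol\xi$ blocks a first-order flex $\dot P$ if $\boldsymbol\xi^\top\mathcal R(\dot P)\dot P\neq0$. *)

theory Defs
  imports "HOL-Analysis.Analysis" "HOL-Library.Function_Algebras"
begin

text \<open>The pointwise vector space structure on functions, so that \<open>\<real>\<^sup>d\<^sup>V \<oplus> \<real>\<^sup>d\<^sup>F\<close> and
  \<open>\<real>\<^sup>E \<oplus> \<real>\<^sup>V\<^sup>F\<close> can be treated as subspaces of real vector spaces.\<close>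

instantiation "fun" :: (type, real_vector) real_vector
begin

definition scaleR_fun :: "real \<Rightarrow> ('a \<Rightarrow> 'b) \<Rightarrow> 'a \<Rightarrow> 'b"
  where "scaleR_fun c f = (\<lambda>x. c *\<^sub>R f x)"

instance
  by standard (simp_all add: scaleR_fun_def fun_eq_iff scaleR_add_right scaleR_add_left)

end


section \<open>Combinatorial data of a polytope\<close>

text \<open>Vertices are indexed by themselves, facets by themselves as point sets, and an edge
  \<open>ij\<close> by the unordered pair \<open>{i, j}\<close> of its endpoints.\<close>

definition verts :: "'a::euclidean_space set \<Rightarrow> 'a set"
  where "verts P = {v. v extreme_point_of P}"

definition edges :: "'a::euclidean_space set \<Rightarrow> 'a set set"
  where "edges P = {{i, j} | i j. i \<in> verts P \<and> j \<in> verts P \<and> closed_segment i j edge_of P}"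

definition facets :: "'a::euclidean_space set \<Rightarrow> 'a set set"
  where "facets P = {\<sigma>. \<sigma> facet_of P}"

definition incidences :: "'a::euclidean_space set \<Rightarrow> ('a \<times> 'a set) set"
  where "incidences P = {(i, \<sigma>). i \<in> verts P \<and> \<sigma> \<in> facets P \<and> i \<in> \<sigma>}"

definition is_facet_normal :: "'a::euclidean_space set \<Rightarrow> 'a set \<Rightarrow> 'a \<Rightarrow> bool"
  where "is_facet_normal P \<sigma> a \<longleftrightarrow>
    (\<forall>i\<in>verts P. (i \<in> \<sigma> \<longrightarrow> i \<bullet> a = 1) \<and> (i \<notin> \<sigma> \<longrightarrow> i \<bullet> a < 1))"

text \<open>Well defined if the origin is in the interior, see \<open>ex1_facet_normal\<close> below.\<close>

definition facet_normal :: "'a::euclidean_space set \<Rightarrow> 'a set \<Rightarrow> 'a"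
  where "facet_normal P \<sigma> = (THE a. is_facet_normal P \<sigma> a)"


section \<open>The rigidity matrix\<close>

text \<open>Pairs \<open>(q, b)\<close> of maps \<open>V \<rightarrow> \<real>\<^sup>d\<close>, \<open>F \<rightarrow> \<real>\<^sup>d\<close>, and vectors of \<open>\<real>\<^sup>E \<oplus> \<real>\<^sup>V\<^sup>F\<close>. A map
  on a finite index set is represented by its extension by zero.\<close>

type_synonym 'a config = "('a \<Rightarrow> 'a) \<times> ('a set \<Rightarrow> 'a)"
type_synonym 'a stress = "('a set \<Rightarrow> real) \<times> ('a \<times> 'a set \<Rightarrow> real)"

definition config_space :: "'a::euclidean_space set \<Rightarrow> 'a config set"
  where "config_space P = {(q, b). (\<forall>i. i \<notin> verts P \<longrightarrow> q i = 0) \<and> (\<forall>\<sigma>. \<sigma> \<notin> facets P \<longrightarrow> b \<sigma> = 0)}"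

definition stress_space :: "'a::euclidean_space set \<Rightarrow> 'a stress set"
  where "stress_space P =
    {(\<omega>, \<alpha>). (\<forall>e. e \<notin> edges P \<longrightarrow> \<omega> e = 0) \<and> (\<forall>x. x \<notin> incidences P \<longrightarrow> \<alpha> x = 0)}"

definition realization :: "'a::euclidean_space set \<Rightarrow> 'a config"
  where "realization P =
    (\<lambda>i. if i \<in> verts P then i else 0, \<lambda>\<sigma>. if \<sigma> \<in> facets P then facet_normal P \<sigma> else 0)"

text \<open>For \<open>e = {i, j}\<close> with \<open>i \<noteq> j\<close> this is \<open>\<langle>q\<^sub>i - q\<^sub>j, p\<^sub>i - p\<^sub>j\<rangle>\<close> (lemma \<open>edge_entry_pair\<close>):
  both orders of the endpoints contribute the same term, hence the factor \<open>1/2\<close>.\<close>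

definition edge_entry :: "('a \<Rightarrow> 'a::euclidean_space) \<Rightarrow> ('a \<Rightarrow> 'a) \<Rightarrow> 'a set \<Rightarrow> real"
  where "edge_entry q p e = (\<Sum>i\<in>e. \<Sum>j\<in>e. (q i - q j) \<bullet> (p i - p j)) / 2"

text \<open>\<open>rigidity P (q, b)\<close> is the linear map \<open>\<R>(q, b)\<close>; it depends on \<open>P\<close> only through
  \<open>E\<close> and \<open>VF\<close>.\<close>

definition rigidity :: "'a::euclidean_space set \<Rightarrow> 'a config \<Rightarrow> 'a config \<Rightarrow> 'a stress"
  where "rigidity P = (\<lambda>(q, b) (p, a).
    (\<lambda>e. if e \<in> edges P then edge_entry q p e else 0,
     \<lambda>(i, \<sigma>). if (i, \<sigma>) \<in> incidences P then q i \<bullet> a \<sigma> + p i \<bullet> b \<sigma> else 0))"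

text \<open>The standard inner product of \<open>\<real>\<^sup>E \<oplus> \<real>\<^sup>V\<^sup>F\<close>.\<close>

definition stress_inner :: "'a::euclidean_space set \<Rightarrow> 'a stress \<Rightarrow> 'a stress \<Rightarrow> real"
  where "stress_inner P \<xi> y =
    (\<Sum>e\<in>edges P. fst \<xi> e * fst y e) + (\<Sum>x\<in>incidences P. snd \<xi> x * snd y x)"

text \<open>The standard basis of \<open>\<real>\<^sup>d\<^sup>V \<oplus> \<real>\<^sup>d\<^sup>F\<close>; it indexes the columns of the rigidity matrix, the
  column at \<open>x\<close> being \<open>\<R>(q, b) x\<close>.\<close>

definition unit_configs :: "'a::euclidean_space set \<Rightarrow> 'a config set"
  where "unit_configs P =
    {(\<lambda>k. if k = i then u else 0, \<lambda>_. 0) | i u. i \<in> verts P \<and> u \<in> Basis} \<union>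
    {(\<lambda>_. 0, \<lambda>\<tau>. if \<tau> = \<sigma> then u else 0) | \<sigma> u. \<sigma> \<in> facets P \<and> u \<in> Basis}"


section \<open>Motions and stresses\<close>

definition motions :: "'a::euclidean_space set \<Rightarrow> 'a config set"
  where "motions P = {M \<in> config_space P. rigidity P (realization P) M = 0}"

definition trivial_motions :: "'a::euclidean_space set \<Rightarrow> 'a config set"
  where "trivial_motions P =
    {M \<in> motions P. \<forall>i\<in>verts P. \<forall>j\<in>verts P. (i - j) \<bullet> (fst M i - fst M j) = 0}"

definition flexes :: "'a::euclidean_space set \<Rightarrow> 'a config set"
  where "flexes P = motions P - trivial_motions P"

text \<open>The entry of \<open>\<R>(P)\<^sup>T \<xi>\<close> at \<open>x\<close> is the inner product of \<open>\<xi>\<close> with the column at \<open>x\<close>.\<close>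

definition equilibrium_stresses :: "'a::euclidean_space set \<Rightarrow> 'a stress set"
  where "equilibrium_stresses P =
    {\<xi> \<in> stress_space P.
      \<forall>x\<in>unit_configs P. stress_inner P \<xi> (rigidity P (realization P) x) = 0}"

definition blocks :: "'a::euclidean_space set \<Rightarrow> 'a stress \<Rightarrow> 'a config \<Rightarrow> bool"
  where "blocks P \<xi> M \<longleftrightarrow> stress_inner P \<xi> (rigidity P M M) \<noteq> 0"

definition is_basis :: "'v::real_vector set \<Rightarrow> nat \<Rightarrow> (nat \<Rightarrow> 'v) \<Rightarrow> bool"
  where "is_basis K s x \<longleftrightarrow>
    inj_on x {..<s} \<and> independent (x ` {..<s}) \<and> span (x ` {..<s}) = K"

definition lincomb :: "nat \<Rightarrow> (nat \<Rightarrow> 'v::real_vector) \<Rightarrow> (nat \<Rightarrow> real) \<Rightarrow> 'v"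
  where "lincomb r x l = (\<Sum>i<r. l i *\<^sub>R x i)"

text \<open>For subspaces \<open>T \<subseteq> K\<close>: the cosets \<open>x\<^sub>i + T\<close>, \<open>i < r\<close>, form a basis of \<open>K / T\<close>.\<close>

definition represents_quotient_basis ::
    "'v::real_vector set \<Rightarrow> 'v set \<Rightarrow> nat \<Rightarrow> (nat \<Rightarrow> 'v) \<Rightarrow> bool"
  where "represents_quotient_basis K T r x \<longleftrightarrow>
    (\<forall>i<r. x i \<in> K) \<and>
    (\<forall>l. lincomb r x l \<in> T \<longrightarrow> (\<forall>i<r. l i = 0)) \<and>
    (\<forall>y\<in>K. \<exists>l. y - lincomb r x l \<in> T)"

text \<open>With \<open>l\<close> for \<open>\<lambda>\<close>, \<open>stress_energy P r M s \<xi> l \<mu>\<close> is \<open>E(\<lambda>, \<mu>)\<close> and \<open>energy_form P r M \<xi>\<^sub>j\<close> is the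
  quadratic form \<open>Q\<^sub>j\<close>.\<close>

definition stress_energy :: "'a::euclidean_space set \<Rightarrow> nat \<Rightarrow> (nat \<Rightarrow> 'a config) \<Rightarrow>
    nat \<Rightarrow> (nat \<Rightarrow> 'a stress) \<Rightarrow> (nat \<Rightarrow> real) \<Rightarrow> (nat \<Rightarrow> real) \<Rightarrow> real"
  where "stress_energy P r M s \<xi> l \<mu> =
    stress_inner P (lincomb s \<xi> \<mu>) (rigidity P (lincomb r M l) (lincomb r M l))"

definition energy_form :: "'a::euclidean_space set \<Rightarrow> nat \<Rightarrow> (nat \<Rightarrow> 'a config) \<Rightarrow>
    'a stress \<Rightarrow> (nat \<Rightarrow> real) \<Rightarrow> real"
  where "energy_form P r M \<xi> l =
    stress_inner P \<xi> (rigidity P (lincomb r M l) (lincomb r M l))"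


section \<open>Well-definedness\<close>

lemma edge_entry_pair:
  assumes "i \<noteq> j"
  shows "edge_entry q p {i, j} = (q i - q j) \<bullet> (p i - p j)"
proof -
  have "edge_entry q p {i, j} = ((q i - q j) \<bullet> (p i - p j) + (q j - q i) \<bullet> (p j - p i)) / 2"
    using assms by (simp add: edge_entry_def)
  also have "(q j - q i) \<bullet> (p j - p i) = (q i - q j) \<bullet> (p i - p j)"
    by (metis inner_minus_left inner_minus_right minus_diff_eq minus_minus)
  finally show ?thesis by simp
qed

lemma edges_distinct:
  assumes "e \<in> edges P"
  obtains i j where "i \<in> verts P" "j \<in> verts P" "i \<noteq> j" "e = {i, j}"
proof -
  obtain i j where ij: "i \<in> verts P" "j \<in> verts P" "e = {i, j}" "aff_dim (closed_segment i j) = 1"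
    using assms by (auto simp: edges_def edge_of_def)
  then have "i \<noteq> j" by auto
  with ij show thesis using that by blast
qed

lemma ex1_facet_normal:
  fixes P :: "'a::euclidean_space set"
  assumes P: "polytope P" "0 \<in> interior P" and \<sigma>: "\<sigma> \<in> facets P"
  shows "\<exists>!a. is_facet_normal P \<sigma> a"
proof -
  have fc: "\<sigma> facet_of P" using \<sigma> by (simp add: facets_def)
  then have face: "\<sigma> face_of P" by (simp add: facet_of_def)
  obtain a0 b where a0: "a0 \<noteq> 0" "P \<subseteq> {x. a0 \<bullet> x \<le> b}" "\<sigma> = P \<inter> {x. a0 \<bullet> x = b}"
    using facet_of_polyhedron[OF polytope_imp_polyhedron[OF P(1)] fc] by metis
  obtain e where e: "e > 0" "cball 0 e \<subseteq> P"
    using P(2) mem_interior_cball by blast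
  have "(e / norm a0) *\<^sub>R a0 \<in> P" using e a0(1) by (intro subsetD[OF e(2)]) simp
  then have "(e / norm a0) * (a0 \<bullet> a0) \<le> b" using a0(2) by auto
  moreover have "(e / norm a0) * (a0 \<bullet> a0) > 0" using e a0(1) by simp
  ultimately have b: "b > 0" by linarith
  define a where "a = a0 /\<^sub>R b"
  have aP: "x \<bullet> a \<le> 1" if "x \<in> P" for x
    using a0(2) that b by (auto simp: a_def inner_commute field_simps)
  have a\<sigma>: "\<sigma> = P \<inter> {x. x \<bullet> a = 1}"
    using b by (auto simp: a0(3) a_def inner_commute field_simps)
  have vP: "verts P \<subseteq> P" by (auto simp: verts_def extreme_point_of_def)
  have ex: "is_facet_normal P \<sigma> a"
    unfolding is_facet_normal_def using aP a\<sigma> vP by (force simp: order.strict_iff_order)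
  have c\<sigma>: "convex \<sigma>" "compact \<sigma>"
    using face P(1) face_of_imp_convex face_of_imp_compact polytope_imp_convex polytope_imp_compact
    by blast+
  have hull: "\<sigma> = convex hull {x. x extreme_point_of \<sigma>}"
    by (rule Krein_Milman_Minkowski) (use c\<sigma> in auto)
  have on: "\<sigma> \<subseteq> {x. c \<bullet> x = 1}" if "is_facet_normal P \<sigma> c" for c
  proof -
    have "{x. x extreme_point_of \<sigma>} \<subseteq> {x. c \<bullet> x = 1}"
      using that extreme_point_of_face[OF face]
      by (auto simp: is_facet_normal_def verts_def inner_commute)
    then show ?thesis
      by (subst hull) (intro hull_minimal, auto simp: convex_hyperplane)
  qed
  have uniq: "c = a" if c: "is_facet_normal P \<sigma> c" for c
  proof -
    have "a \<noteq> 0" using a0(1) b by (simp add: a_def)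
    have "aff_dim P = DIM('a)" using P(2) by (intro aff_dim_nonempty_interior) auto
    then have d: "aff_dim \<sigma> = DIM('a) - 1" using fc by (simp add: facet_of_def)
    have sub': "\<sigma> \<subseteq> {x. a \<bullet> x = 1}" by (rule on[OF ex])
    have "aff_dim \<sigma> = aff_dim {x. a \<bullet> x = 1}"
      using d \<open>a \<noteq> 0\<close> by simp
    then have "affine hull \<sigma> = affine hull {x. a \<bullet> x = 1}"
      using aff_dim_eq_full_gen[OF sub'] by simp
    then have "affine hull \<sigma> = {x. a \<bullet> x = 1}"
      by (simp add: hull_same affine_hyperplane)
    then have sub2: "{x. a \<bullet> x = 1} \<subseteq> {x. c \<bullet> x = 1}"
      using on[OF c] by (metis affine_hyperplane hull_minimal)
    define x0 where "x0 = a /\<^sub>R (a \<bullet> a)"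
    have x0: "a \<bullet> x0 = 1" using \<open>a \<noteq> 0\<close> by (simp add: x0_def)
    have cx0: "c \<bullet> x0 = 1" using x0 sub2 by blast
    have cw: "c \<bullet> w = a \<bullet> w" for w
    proof -
      have "a \<bullet> (w + (1 - a \<bullet> w) *\<^sub>R x0) = 1" using x0 by (simp add: inner_add_right)
      then have "c \<bullet> (w + (1 - a \<bullet> w) *\<^sub>R x0) = 1" using sub2 by blast
      then show ?thesis using cx0 by (simp add: inner_add_right)
    qed
    then show ?thesis by (metis vector_eq_ldot vector_eq_rdot)
  qed
  show ?thesis using ex uniq by blast
qed

end

theory Submission
  imports Defs
begin

text \<open>The form \<open>\<R>(x) y\<close> is bilinear and symmetric, so it suffices to show that an equilibrium
  stress annihilates \<open>\<R>(N) T\<close> whenever \<open>N = (q, c)\<close> is a first-order motion and \<open>T\<close> is trivial: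
  then \<open>\<xi>\<^sup>T \<R>(N) N\<close> depends only on the class of \<open>N\<close>. Since \<open>P\<close> is full-dimensional, there are a
  skew map \<open>S\<close> and a vector \<open>w\<close> with \<open>T\<^sub>i = S p\<^sub>i + w\<close> at the vertices, and as
  the vertices of a facet span the whole space, \<open>T\<^sub>\<sigma> = S a\<^sub>\<sigma> - \<langle>w, a\<^sub>\<sigma>\<rangle> a\<^sub>\<sigma>\<close> at the facets. A
  direct computation now gives \<open>\<R>(N) T = \<R>(P) (x, y)\<close> for \<open>x\<^sub>i = - S q\<^sub>i\<close> and
  \<open>y\<^sub>\<sigma> = \<langle>w, a\<^sub>\<sigma>\<rangle> c\<^sub>\<sigma> + \<langle>w, c\<^sub>\<sigma>\<rangle> a\<^sub>\<sigma> - S c\<^sub>\<sigma>\<close>, and equilibrium stresses annihilate the image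
  of \<open>\<R>(P)\<close>.\<close>

section \<open>Bilinearity and symmetry of the stress form\<close>

lemma sum_fun_apply: "(sum f A) x = (\<Sum>a\<in>A. f a x)"
  by (induction A rule: infinite_finite_induct) auto

lemma linear_stress_inner: "linear (stress_inner P \<xi>)"
  by (rule linearI)
    (simp_all add: stress_inner_def scaleR_fun_def distrib_left sum.distrib sum_distrib_left
      mult_ac)

lemma linear_stress_inner_left: "linear (\<lambda>\<xi>. stress_inner P \<xi> y)"
  using linear_stress_inner[of P y] unfolding stress_inner_def by (simp only: mult.commute)

lemma edge_entry_add_right: "edge_entry q (p + p') e = edge_entry q p e + edge_entry q p' e"
  by (simp add: edge_entry_def inner_simps sum.distrib sum_subtractf add_divide_distrib
      diff_divide_distrib)

lemma edge_entry_scaleR_right: "edge_entry q (c *\<^sub>R p) e = c * edge_entry q p e"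
  by (simp add: edge_entry_def scaleR_fun_def sum_distrib_left mult_ac flip: scaleR_diff_right)

lemma linear_rigidity: "linear (rigidity P x)"
proof (rule linearI)
  fix y z and c :: real
  show "rigidity P x (y + z) = rigidity P x y + rigidity P x z"
    by (cases x; cases y; cases z)
      (auto simp: rigidity_def fun_eq_iff edge_entry_add_right inner_simps)
  show "rigidity P x (c *\<^sub>R y) = c *\<^sub>R rigidity P x y"
    by (cases x; cases y)
      (auto simp: rigidity_def fun_eq_iff edge_entry_scaleR_right[unfolded scaleR_fun_def]
        scaleR_fun_def distrib_left)
qed

lemma rigidity_commute: "rigidity P x y = rigidity P y x"
  by (auto simp: rigidity_def fun_eq_iff edge_entry_def inner_commute split: prod.splits)

text \<open>Linearity is checked in the second argument only; the symmetry
  \<open>rigidity_commute\<close> carries it over to the first.\<close>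

lemma bilinear_stress_rigidity: "bilinear (\<lambda>x y. stress_inner P \<xi> (rigidity P x y))"
proof -
  have "linear (\<lambda>y. stress_inner P \<xi> (rigidity P x y))" for x
    using linear_compose[OF linear_rigidity linear_stress_inner] by (simp add: o_def)
  then show ?thesis
    unfolding bilinear_def by (metis (no_types, lifting) ext rigidity_commute)
qed

section \<open>Equilibrium stresses and the image of the rigidity map\<close>

lemma finite_verts: "polytope P \<Longrightarrow> finite (verts P)"
  unfolding verts_def
  using finite_polyhedron_extreme_points polytope_imp_polyhedron by blast

lemma finite_facets: "polytope P \<Longrightarrow> finite (facets P)"
  unfolding facets_def
  using finite_polyhedron_facets polytope_imp_polyhedron by blast

lemma config_space_subset_span:
  assumes "polytope P"
  shows "config_space P \<subseteq> span (unit_configs P)"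
proof clarify
  fix p a assume pa: "(p, a) \<in> config_space P"
  define U :: "'a \<Rightarrow> 'a \<Rightarrow> 'a config"
    where "U i u = (\<lambda>k. if k = i then u else 0, \<lambda>_. 0)" for i u
  define W :: "'a set \<Rightarrow> 'a \<Rightarrow> 'a config"
    where "W \<sigma> u = (\<lambda>_. 0, \<lambda>\<tau>. if \<tau> = \<sigma> then u else 0)" for \<sigma> u
  \<comment> \<open>Coordinate expansion. Outside \<open>verts P\<close> every summand is 0, which
    agrees with the extension by zero built into \<open>config_space\<close>.\<close>
  have p: "p k = (\<Sum>i\<in>verts P. \<Sum>u\<in>Basis. (p i \<bullet> u) *\<^sub>R (if k = i then u else 0))" for k
  proof -
    have "(\<Sum>u\<in>Basis. (p i \<bullet> u) *\<^sub>R (if k = i then u else 0)) = (if k = i then p i else 0)" for i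
      by (simp add: euclidean_representation)
    then show ?thesis
      using pa by (simp add: finite_verts[OF assms] config_space_def)
  qed
  have a: "a \<tau> = (\<Sum>\<sigma>\<in>facets P. \<Sum>u\<in>Basis. (a \<sigma> \<bullet> u) *\<^sub>R (if \<tau> = \<sigma> then u else 0))" for \<tau>
  proof -
    have "(\<Sum>u\<in>Basis. (a \<sigma> \<bullet> u) *\<^sub>R (if \<tau> = \<sigma> then u else 0)) = (if \<tau> = \<sigma> then a \<sigma> else 0)" for \<sigma>
      by (simp add: euclidean_representation)
    then show ?thesis
      using pa by (simp add: finite_facets[OF assms] config_space_def)
  qed
  have "(p, a) = (\<Sum>i\<in>verts P. \<Sum>u\<in>Basis. (p i \<bullet> u) *\<^sub>R U i u)
      + (\<Sum>\<sigma>\<in>facets P. \<Sum>u\<in>Basis. (a \<sigma> \<bullet> u) *\<^sub>R W \<sigma> u)"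
  proof (rule prod_eqI; rule ext)
    fix k \<tau>
    show "fst (p, a) k = fst ((\<Sum>i\<in>verts P. \<Sum>u\<in>Basis. (p i \<bullet> u) *\<^sub>R U i u)
        + (\<Sum>\<sigma>\<in>facets P. \<Sum>u\<in>Basis. (a \<sigma> \<bullet> u) *\<^sub>R W \<sigma> u)) k"
      unfolding fst_conv by (rule trans[OF p]) (simp add: fst_sum sum_fun_apply U_def W_def scaleR_fun_def)
    show "snd (p, a) \<tau> = snd ((\<Sum>i\<in>verts P. \<Sum>u\<in>Basis. (p i \<bullet> u) *\<^sub>R U i u)
        + (\<Sum>\<sigma>\<in>facets P. \<Sum>u\<in>Basis. (a \<sigma> \<bullet> u) *\<^sub>R W \<sigma> u)) \<tau>"
      unfolding snd_conv by (rule trans[OF a]) (simp add: snd_sum sum_fun_apply U_def W_def scaleR_fun_def)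
  qed
  moreover have "U i u \<in> span (unit_configs P)" if "i \<in> verts P" "u \<in> Basis" for i u
    using that unfolding unit_configs_def U_def by (blast intro: span_base)
  moreover have "W \<sigma> u \<in> span (unit_configs P)" if "\<sigma> \<in> facets P" "u \<in> Basis" for \<sigma> u
    using that unfolding unit_configs_def W_def by (blast intro: span_base)
  ultimately show "(p, a) \<in> span (unit_configs P)"
    by (simp add: span_add span_sum span_scale)
qed

text \<open>Equilibrium is defined by testing against the columns at unit configurations; linearity
  extends this to their span, which contains every configuration.\<close>

lemma equilibrium_stress_image:
  assumes "polytope P" "\<xi> \<in> equilibrium_stresses P" "x \<in> config_space P"
  shows "stress_inner P \<xi> (rigidity P (realization P) x) = 0"
proof -
  have "linear (\<lambda>x. stress_inner P \<xi> (rigidity P (realization P) x))"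
    using bilinear_stress_rigidity unfolding bilinear_def by blast
  then show ?thesis
  proof (rule linear_eq_0_on_span)
    show "x \<in> span (unit_configs P)"
      using config_space_subset_span assms by blast
  qed (use assms(2) in \<open>auto simp: equilibrium_stresses_def\<close>)
qed

section \<open>Infinitesimal isometries of the vertex set\<close>

lemma polytope_eq_hull_verts: "polytope P \<Longrightarrow> P = convex hull verts P"
  unfolding verts_def
  by (rule Krein_Milman_Minkowski) (simp_all add: polytope_imp_compact polytope_imp_convex)

text \<open>Otherwise the vertices, and with them their hull \<open>P\<close>, would lie in one
  hyperplane, which has empty interior.\<close>

lemma span_vertex_differences:
  assumes "polytope P" "interior P \<noteq> {}" "p0 \<in> verts P"
  shows "span ((\<lambda>p. p - p0) ` verts P) = UNIV"
proof (rule ccontr)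
  assume "\<not> ?thesis"
  then obtain z where z: "z \<noteq> 0" "span ((\<lambda>p. p - p0) ` verts P) \<subseteq> {x. z \<bullet> x = 0}"
    using span_not_univ_subset_hyperplane by blast
  have "z \<bullet> (p - p0) = 0" if "p \<in> verts P" for p
    using z(2) that by (blast intro: span_base)
  then have "verts P \<subseteq> {x. z \<bullet> x = z \<bullet> p0}"
    by (auto simp: inner_diff_right)
  then have "P \<subseteq> {x. z \<bullet> x = z \<bullet> p0}"
    by (subst polytope_eq_hull_verts[OF assms(1)]) (intro hull_minimal convex_hyperplane)
  then have "interior P \<subseteq> interior {x. z \<bullet> x = z \<bullet> p0}"
    by (rule interior_mono)
  then show False
    using z(1) assms(2) by simp
qed

text \<open>Linearity of \<open>f\<close> is not assumed: \<open>S\<close> is built from the values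
  of \<open>f\<close> on a basis inside \<open>D\<close>, and skewness alone forces agreement on the
  rest of \<open>D\<close>.\<close>

lemma skew_extension:
  fixes f :: "'a::euclidean_space \<Rightarrow> 'a"
  assumes span: "span D = UNIV"
    and skew: "\<And>x y. x \<in> D \<Longrightarrow> y \<in> D \<Longrightarrow> f x \<bullet> y = - (x \<bullet> f y)"
  obtains S where "linear S" "\<And>x y. S x \<bullet> y = - (x \<bullet> S y)" "\<And>x. x \<in> D \<Longrightarrow> S x = f x"
proof -
  obtain B where B: "B \<subseteq> D" "independent B" "D \<subseteq> span B"
    using maximal_independent_subset by blast
  have spanB: "span B = UNIV"
    using B(3) span by (metis span_mono span_span top.extremum_uniqueI)
  obtain S where S: "linear S" "\<And>x. x \<in> B \<Longrightarrow> S x = f x"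
    using linear_independent_extend[OF B(2)] by metis
  have bil: "bilinear (\<lambda>x y. S x \<bullet> y)" "bilinear (\<lambda>x y. - (x \<bullet> S y))"
    using S(1) by (auto simp: bilinear_def linear_iff inner_simps)
  have skewB: "S x \<bullet> y = - (x \<bullet> S y)" if "x \<in> B" "y \<in> B" for x y
    using that S(2) skew B(1) by (simp add: subset_iff)
  \<comment> \<open>Both sides are bilinear, so the pairs of basis vectors suffice.\<close>
  have skewS: "S x \<bullet> y = - (x \<bullet> S y)" for x y
    by (rule bilinear_eq[OF bil, where S = UNIV and T = UNIV and B = B and C = B])
      (simp_all add: spanB skewB)
  have "S x = f x" if "x \<in> D" for x
  proof -
    \<comment> \<open>Moving \<open>S\<close> and \<open>f\<close> over to \<open>y\<close> by
      skewness reduces the claim to \<open>S y = f y\<close>, which holds on the basis.\<close>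
    have "y \<bullet> (S x - f x) = 0" if "y \<in> B" for y
      using skewS[of y x] S(2)[OF that] skew[of y x] that \<open>x \<in> D\<close> B(1)
      by (auto simp: inner_diff_right)
    then have "B \<subseteq> {y. (S x - f x) \<bullet> y = 0}"
      by (auto simp: inner_commute)
    then have "span B \<subseteq> {y. (S x - f x) \<bullet> y = 0}"
      by (intro span_minimal subspace_hyperplane)
    then have "(S x - f x) \<bullet> (S x - f x) = 0"
      using spanB by blast
    then show ?thesis by simp
  qed
  then show thesis using that S(1) skewS by blast
qed

lemma infinitesimal_isometry:
  fixes P :: "'a::euclidean_space set"
  assumes P: "polytope P" "interior P \<noteq> {}"
    and iso: "\<And>i j. i \<in> verts P \<Longrightarrow> j \<in> verts P \<Longrightarrow> (i - j) \<bullet> (t i - t j) = 0"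
  obtains S w where "linear S" "\<And>x y. S x \<bullet> y = - (x \<bullet> S y)" "\<And>i. i \<in> verts P \<Longrightarrow> t i = S i + w"
proof -
  have "verts P \<noteq> {}"
    using P(2) polytope_eq_hull_verts[OF P(1)] by (metis convex_hull_empty interior_empty)
  then obtain p0 where p0: "p0 \<in> verts P" by blast
  \<comment> \<open>Velocity relative to \<open>p0\<close>, as a function of the difference vector;
    only its values at vertex differences matter.\<close>
  define f where "f d = t (d + p0) - t p0" for d
  have "f x \<bullet> y = - (x \<bullet> f y)"
    if x: "x \<in> (\<lambda>p. p - p0) ` verts P" and y: "y \<in> (\<lambda>p. p - p0) ` verts P" for x y
  proof -
    obtain i j where ij: "i \<in> verts P" "j \<in> verts P" "x = i - p0" "y = j - p0"
      using x y by blast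
    show ?thesis
      \<comment> \<open>Polarization: \<open>x\<close>, \<open>y\<close> and \<open>x - y\<close>
        are each orthogonal to their relative velocities, so the mixed terms cancel.\<close>
      using iso[OF ij(1) p0] iso[OF ij(2) p0] iso[OF ij(1,2)]
      by (simp add: ij f_def inner_simps inner_commute)
  qed
  then obtain S where S: "linear S" "\<And>x y. S x \<bullet> y = - (x \<bullet> S y)"
      "\<And>x. x \<in> (\<lambda>p. p - p0) ` verts P \<Longrightarrow> S x = f x"
    using skew_extension[OF span_vertex_differences[OF P p0]] by metis
  have "t i = S i + (t p0 - S p0)" if "i \<in> verts P" for i
    using S(3)[of "i - p0"] that by (simp add: f_def linear_diff[OF S(1)] algebra_simps)
  with S show thesis using that by blast
qed

section \<open>Trivial motions at the facets\<close>

lemma facet_normal_inner: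
  assumes "polytope P" "0 \<in> interior P" "(i, \<sigma>) \<in> incidences P"
  shows "i \<bullet> facet_normal P \<sigma> = 1"
proof -
  have "is_facet_normal P \<sigma> (facet_normal P \<sigma>)"
    unfolding facet_normal_def
    using theI'[OF ex1_facet_normal] assms by (auto simp: incidences_def)
  then show ?thesis
    using assms(3) by (auto simp: is_facet_normal_def incidences_def)
qed

text \<open>A non-zero \<open>z\<close> would put the facet into a hyperplane through the origin of
  the same dimension, so its affine hull would contain 0. But that hull lies where the product with
  the facet normal is 1.\<close>

lemma facet_vertices_separate:
  fixes P :: "'a::euclidean_space set"
  assumes P: "polytope P" "0 \<in> interior P" and \<sigma>: "\<sigma> \<in> facets P"
    and z: "\<And>i. (i, \<sigma>) \<in> incidences P \<Longrightarrow> i \<bullet> z = 0"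
  shows "z = 0"
proof (rule ccontr)
  assume "z \<noteq> 0"
  have face: "\<sigma> face_of P" and dim: "aff_dim \<sigma> = aff_dim P - 1"
    using \<sigma> by (auto simp: facets_def facet_of_def)
  have "polytope \<sigma>"
    using face P(1) face_of_polytope_polytope by blast
  then have hull: "\<sigma> = convex hull verts \<sigma>"
    by (rule polytope_eq_hull_verts)
  have inc: "(i, \<sigma>) \<in> incidences P" if "i \<in> verts \<sigma>" for i
    using that \<sigma> extreme_point_of_face[OF face] by (auto simp: incidences_def verts_def)
  have on_z: "\<sigma> \<subseteq> {x. z \<bullet> x = 0}"
    by (subst hull, intro hull_minimal convex_hyperplane) (auto simp: z inc inner_commute)
  have on_a: "\<sigma> \<subseteq> {x. facet_normal P \<sigma> \<bullet> x = 1}"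
    by (subst hull, intro hull_minimal convex_hyperplane)
      (auto simp: facet_normal_inner[OF P] inc inner_commute)
  have "aff_dim P = DIM('a)"
    using P(2) by (intro aff_dim_nonempty_interior) auto
  then have "aff_dim \<sigma> = aff_dim {x. z \<bullet> x = 0}"
    using dim \<open>z \<noteq> 0\<close> by simp
  then have "affine hull \<sigma> = affine hull {x. z \<bullet> x = 0}"
    using aff_dim_eq_full_gen[OF on_z] by simp
  then have "0 \<in> affine hull \<sigma>"
    by (simp add: hull_same affine_hyperplane)
  moreover have "affine hull \<sigma> \<subseteq> {x. facet_normal P \<sigma> \<bullet> x = 1}"
    using on_a by (intro hull_minimal affine_hyperplane)
  ultimately show False by auto
qed

lemma motion_incidence:
  assumes "(q, c) \<in> motions P" "(i, \<sigma>) \<in> incidences P"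
  shows "q i \<bullet> facet_normal P \<sigma> + i \<bullet> c \<sigma> = 0"
proof -
  have "snd (rigidity P (realization P) (q, c)) (i, \<sigma>) = 0"
    using assms(1) by (simp add: motions_def)
  then show ?thesis
    using assms(2) by (auto simp: rigidity_def realization_def incidences_def)
qed

text \<open>The vertex part is an infinitesimal isometry. The incidence equations then fix the
  products of \<open>b \<sigma>\<close> with the vertices of \<open>\<sigma>\<close>, and these
  determine \<open>b \<sigma>\<close>.\<close>

lemma trivial_motion_form:
  fixes P :: "'a::euclidean_space set"
  assumes P: "polytope P" "0 \<in> interior P" and T: "(t, b) \<in> trivial_motions P"
  obtains S w where "linear S" "\<And>x y. S x \<bullet> y = - (x \<bullet> S y)"
    "\<And>i. i \<in> verts P \<Longrightarrow> t i = S i + w"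
    "\<And>\<sigma>. \<sigma> \<in> facets P \<Longrightarrow>
      b \<sigma> = S (facet_normal P \<sigma>) - (w \<bullet> facet_normal P \<sigma>) *\<^sub>R facet_normal P \<sigma>"
proof -
  have iso: "(i - j) \<bullet> (t i - t j) = 0" if "i \<in> verts P" "j \<in> verts P" for i j
    using T that by (auto simp: trivial_motions_def)
  have int: "interior P \<noteq> {}" using P(2) by blast
  obtain S w where S: "linear S" "\<And>x y. S x \<bullet> y = - (x \<bullet> S y)"
      "\<And>i. i \<in> verts P \<Longrightarrow> t i = S i + w"
    using infinitesimal_isometry[OF P(1) int iso] by metis
  have mot: "(t, b) \<in> motions P" using T by (simp add: trivial_motions_def)
  have "b \<sigma> = S (facet_normal P \<sigma>) - (w \<bullet> facet_normal P \<sigma>) *\<^sub>R facet_normal P \<sigma>"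
    if \<sigma>: "\<sigma> \<in> facets P" for \<sigma>
  proof -
    define a where "a = facet_normal P \<sigma>"
    have "i \<bullet> (b \<sigma> - (S a - (w \<bullet> a) *\<^sub>R a)) = 0" if i: "(i, \<sigma>) \<in> incidences P" for i
    proof -
      have "i \<in> verts P" using i by (simp add: incidences_def)
      then show ?thesis
        using motion_incidence[OF mot i] facet_normal_inner[OF P i] S(2)[of i a] S(3)[of i]
        by (simp add: a_def inner_simps)
    qed
    then have "b \<sigma> - (S a - (w \<bullet> a) *\<^sub>R a) = 0"
      by (rule facet_vertices_separate[OF P \<sigma>])
    then show ?thesis by (simp add: a_def)
  qed
  with S show thesis using that by blast
qed

section \<open>Stresses on motions modulo trivial motions\<close>

lemma rigidity_trivial_motion_in_image:
  fixes P :: "'a::euclidean_space set"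
  assumes P: "polytope P" "0 \<in> interior P"
    and N: "N \<in> motions P" and T: "T \<in> trivial_motions P"
  shows "rigidity P N T \<in> rigidity P (realization P) ` config_space P"
proof -
  obtain q c t b where NT: "N = (q, c)" "T = (t, b)"
    by (metis surj_pair)
  obtain S w where S: "linear S" "\<And>x y. S x \<bullet> y = - (x \<bullet> S y)"
    and t: "\<And>i. i \<in> verts P \<Longrightarrow> t i = S i + w"
    and b: "\<And>\<sigma>. \<sigma> \<in> facets P \<Longrightarrow>
      b \<sigma> = S (facet_normal P \<sigma>) - (w \<bullet> facet_normal P \<sigma>) *\<^sub>R facet_normal P \<sigma>"
    using trivial_motion_form[OF P] T NT by metis
  define a where "a = snd (realization P)"
  \<comment> \<open>The witness \<open>(x, y)\<close> is minus the derivative, in direction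
    \<open>(q, c)\<close>, of the field sending \<open>p\<close> to \<open>S p + w\<close> and
    \<open>a\<close> to \<open>S a - (w \<bullet> a) a\<close>.\<close>
  define x where "x i = - S (q i)" for i
  define y where "y \<sigma> = (w \<bullet> a \<sigma>) *\<^sub>R c \<sigma> + (w \<bullet> c \<sigma>) *\<^sub>R a \<sigma> - S (c \<sigma>)" for \<sigma>
  have "(x, y) \<in> config_space P"
    using N NT linear_0[OF S(1)] by (auto simp: motions_def config_space_def x_def y_def)
  moreover have "edge_entry q t e = edge_entry (fst (realization P)) x e" if e: "e \<in> edges P" for e
  proof -
    obtain i j where ij: "i \<in> verts P" "j \<in> verts P" "i \<noteq> j" "e = {i, j}"
      by (rule edges_distinct[OF e])
    have "t i - t j = S (i - j)" "x i - x j = - S (q i - q j)"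
      using ij t by (simp_all add: x_def linear_diff[OF S(1)])
    then show ?thesis
      using ij S(2)[of "i - j" "q i - q j"]
      by (simp add: edge_entry_pair realization_def inner_commute)
  qed
  moreover have "q i \<bullet> b \<sigma> + t i \<bullet> c \<sigma> = i \<bullet> y \<sigma> + x i \<bullet> a \<sigma>" if i: "(i, \<sigma>) \<in> incidences P" for i \<sigma>
  proof -
    have "i \<in> verts P" and \<sigma>: "\<sigma> \<in> facets P" using i by (auto simp: incidences_def)
    have a: "a \<sigma> = facet_normal P \<sigma>" using \<sigma> by (simp add: a_def realization_def)
    \<comment> \<open>The motion equation of \<open>N\<close> matches the terms with factor
      \<open>w \<bullet> a \<sigma>\<close>, the normalization
      \<open>i \<bullet> a \<sigma> = 1\<close> those with \<open>w \<bullet> c \<sigma>\<close>;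
      skewness handles the terms in \<open>S\<close>.\<close>
    have "q i \<bullet> a \<sigma> = - (i \<bullet> c \<sigma>)"
      using motion_incidence[of q c P i \<sigma>] N NT i a by simp
    moreover have "i \<bullet> a \<sigma> = 1"
      using facet_normal_inner[OF P i] a by simp
    ultimately show ?thesis
      using S(2)[of "q i" "a \<sigma>"] S(2)[of i "c \<sigma>"]
      by (simp add: t[OF \<open>i \<in> verts P\<close>] b[OF \<sigma>] y_def x_def inner_simps flip: a)
  qed
  ultimately have "rigidity P N T = rigidity P (realization P) (x, y)"
    by (auto simp: rigidity_def NT fun_eq_iff a_def incidences_def realization_def)
  with \<open>(x, y) \<in> config_space P\<close> show ?thesis by blast
qed

lemma equilibrium_stress_trivial_motion:
  assumes "polytope P" "0 \<in> interior P" "\<xi> \<in> equilibrium_stresses P"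
    and "N \<in> motions P" "T \<in> trivial_motions P"
  shows "stress_inner P \<xi> (rigidity P N T) = 0"
  using rigidity_trivial_motion_in_image[OF assms(1,2,4,5)] equilibrium_stress_image[OF assms(1,3)]
  by auto

text \<open>This makes blocking a property of the class modulo trivial motions. With
  \<open>L = N - T\<close>, every term of the expansion except that of \<open>N\<close> alone pairs
  a motion with the trivial \<open>T\<close>; the square of \<open>T\<close> is included, since
  \<open>T\<close> is itself a motion.\<close>

lemma stress_rigidity_mod_trivial:
  assumes "polytope P" "0 \<in> interior P" "\<xi> \<in> equilibrium_stresses P"
    and "N \<in> motions P" "N - L \<in> trivial_motions P"
  shows "stress_inner P \<xi> (rigidity P L L) = stress_inner P \<xi> (rigidity P N N)"
proof -
  define T where "T = N - L"
  have T: "T \<in> trivial_motions P" "T \<in> motions P" "L = N - T"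
    using assms(5) by (simp_all add: T_def trivial_motions_def)
  note bil = bilinear_stress_rigidity[of P \<xi>]
  have "stress_inner P \<xi> (rigidity P N T) = 0" "stress_inner P \<xi> (rigidity P T T) = 0"
    using equilibrium_stress_trivial_motion assms T by blast+
  then show ?thesis
    unfolding T(3)
    by (simp add: bilinear_lsub[OF bil] bilinear_rsub[OF bil] rigidity_commute[of P T N])
qed

section \<open>The energy and its quadratic forms\<close>

lemma stress_energy_eq:
  "stress_energy P r M s \<xi> l \<mu> = (\<Sum>j<s. \<mu> j * energy_form P r M (\<xi> j) l)"
  by (simp add: stress_energy_def energy_form_def lincomb_def[of s]
    linear_sum[OF linear_stress_inner_left] linear_scale[OF linear_stress_inner_left])

lemma energy_form_quadratic:
  "energy_form P r M \<xi> l =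
    (\<Sum>i<r. \<Sum>k<r. stress_inner P \<xi> (rigidity P (M i) (M k)) * l i * l k)"
proof -
  note bil = bilinear_stress_rigidity[of P \<xi>]
  have "energy_form P r M \<xi> l =
      (\<Sum>(i, k)\<in>{..<r} \<times> {..<r}. stress_inner P \<xi> (rigidity P (l i *\<^sub>R M i) (l k *\<^sub>R M k)))"
    unfolding energy_form_def lincomb_def by (rule bilinear_sum[OF bil])
  also have "\<dots> = (\<Sum>i<r. \<Sum>k<r. stress_inner P \<xi> (rigidity P (l i *\<^sub>R M i) (l k *\<^sub>R M k)))"
    by (rule sum.cartesian_product[symmetric])
  also have "\<dots> = (\<Sum>i<r. \<Sum>k<r. stress_inner P \<xi> (rigidity P (M i) (M k)) * l i * l k)"
    by (simp only: bilinear_lmul[OF bil] bilinear_rmul[OF bil] real_scaleR_def mult_ac)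
  finally show ?thesis .
qed

lemma stress_energy_has_derivative:
  assumes "j < s"
  shows "((\<lambda>t. stress_energy P r M s \<xi> l (\<mu>(j := t)))
    has_real_derivative energy_form P r M (\<xi> j) l) (at x)"
proof -
  \<comment> \<open>Isolating the \<open>j\<close>-th summand shows that the energy is affine in
    \<open>t\<close>, with the quadratic form as slope.\<close>
  have "stress_energy P r M s \<xi> l (\<mu>(j := t)) = t * energy_form P r M (\<xi> j) l
      + (\<Sum>i\<in>{..<s} - {j}. \<mu> i * energy_form P r M (\<xi> i) l)" for t
    using assms by (auto simp: stress_energy_eq sum.remove[of "{..<s}" j] intro!: sum.cong)
  then show ?thesis
    by (auto intro!: derivative_eq_intros)
qed

theorem proposition6p2:
  fixes P :: "'a::euclidean_space set"
    and M :: "nat \<Rightarrow> 'a config" and \<xi> :: "nat \<Rightarrow> 'a stress" and r s :: nat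
  assumes "polytope P" and "0 \<in> interior P"
    and "represents_quotient_basis (motions P) (trivial_motions P) r M"
    and "is_basis (equilibrium_stresses P) s \<xi>"
  shows
    "\<comment> \<open>\<open>E = \<Sum>\<^sub>j \<mu>\<^sub>j Q\<^sub>j\<close>, the \<open>Q\<^sub>j\<close> are quadratic forms, and they are the components of \<open>\<nabla>\<^sub>\<mu> E\<close>\<close>
     (\<forall>l \<mu>. stress_energy P r M s \<xi> l \<mu> = (\<Sum>j<s. \<mu> j * energy_form P r M (\<xi> j) l)) \<and>
     (\<forall>j<s. \<exists>c :: nat \<Rightarrow> nat \<Rightarrow> real. \<forall>l.
        energy_form P r M (\<xi> j) l = (\<Sum>i<r. \<Sum>k<r. c i k * l i * l k)) \<and>
     (\<forall>j<s. \<forall>l \<mu>. ((\<lambda>t. stress_energy P r M s \<xi> l (\<mu>(j := t)))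
        has_real_derivative energy_form P r M (\<xi> j) l) (at (\<mu> j))) \<and>
     ((\<forall>l. (\<forall>j<s. energy_form P r M (\<xi> j) l = 0) \<longrightarrow> (\<forall>i<r. l i = 0)) \<longrightarrow>
        (\<forall>N\<in>flexes P. \<exists>\<zeta>\<in>equilibrium_stresses P. blocks P \<zeta> N)) \<and>
     (\<forall>N\<in>flexes P. \<not> (\<exists>\<zeta>\<in>equilibrium_stresses P. blocks P \<zeta> N) \<longrightarrow>
        (\<exists>l. N - lincomb r M l \<in> trivial_motions P) \<and>
        (\<forall>l. N - lincomb r M l \<in> trivial_motions P \<longrightarrow>
           (\<exists>i<r. l i \<noteq> 0) \<and> (\<forall>j<s. energy_form P r M (\<xi> j) l = 0)))"
proof -
  have \<xi>: "\<xi> j \<in> equilibrium_stresses P" if "j < s" for j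
    using assms(4) that span_base[of "\<xi> j" "\<xi> ` {..<s}"] unfolding is_basis_def by blast
  have zero: "(\<exists>i<r. l i \<noteq> 0) \<and> (\<forall>j<s. energy_form P r M (\<xi> j) l = 0)"
    if N: "N \<in> flexes P" "\<not> (\<exists>\<zeta>\<in>equilibrium_stresses P. blocks P \<zeta> N)"
      and l: "N - lincomb r M l \<in> trivial_motions P" for N l
  proof
    show "\<exists>i<r. l i \<noteq> 0"
    proof (rule ccontr)
      \<comment> \<open>With all coefficients zero, \<open>N\<close> itself would be trivial and
        hence no flex.\<close>
      assume "\<not> ?thesis"
      then have "lincomb r M l = 0" by (simp add: lincomb_def)
      then show False using l N(1) by (simp add: flexes_def)
    qed
    show "\<forall>j<s. energy_form P r M (\<xi> j) l = 0"
    proof (intro allI impI)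
      fix j assume "j < s"
      moreover have "N \<in> motions P" using N(1) by (simp add: flexes_def)
      ultimately have "energy_form P r M (\<xi> j) l = stress_inner P (\<xi> j) (rigidity P N N)"
        unfolding energy_form_def
        by (intro stress_rigidity_mod_trivial[OF assms(1,2)] \<xi> l)
      then show "energy_form P r M (\<xi> j) l = 0"
        using N(2) \<xi>[OF \<open>j < s\<close>] unfolding blocks_def by metis
    qed
  qed
  have ex: "\<exists>l. N - lincomb r M l \<in> trivial_motions P" if "N \<in> flexes P" for N
    using assms(3) that unfolding represents_quotient_basis_def flexes_def by blast
  show ?thesis
  proof (intro conjI)
    show "\<forall>l \<mu>. stress_energy P r M s \<xi> l \<mu> = (\<Sum>j<s. \<mu> j * energy_form P r M (\<xi> j) l)"
      by (simp add: stress_energy_eq)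
    show "\<forall>j<s. \<exists>c :: nat \<Rightarrow> nat \<Rightarrow> real. \<forall>l.
        energy_form P r M (\<xi> j) l = (\<Sum>i<r. \<Sum>k<r. c i k * l i * l k)"
    proof (intro allI impI exI)
      fix j l
      show "energy_form P r M (\<xi> j) l =
          (\<Sum>i<r. \<Sum>k<r. stress_inner P (\<xi> j) (rigidity P (M i) (M k)) * l i * l k)"
        by (rule energy_form_quadratic)
    qed
    show "\<forall>j<s. \<forall>l \<mu>. ((\<lambda>t. stress_energy P r M s \<xi> l (\<mu>(j := t)))
        has_real_derivative energy_form P r M (\<xi> j) l) (at (\<mu> j))"
      by (simp add: stress_energy_has_derivative)
    show "(\<forall>l. (\<forall>j<s. energy_form P r M (\<xi> j) l = 0) \<longrightarrow> (\<forall>i<r. l i = 0)) \<longrightarrow>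
        (\<forall>N\<in>flexes P. \<exists>\<zeta>\<in>equilibrium_stresses P. blocks P \<zeta> N)"
      \<comment> \<open>By contraposition: an unblocked flex has coefficients by \<open>ex\<close>,
        and \<open>zero\<close> makes them a non-zero solution of the system.\<close>
      using ex zero by metis
    show "\<forall>N\<in>flexes P. \<not> (\<exists>\<zeta>\<in>equilibrium_stresses P. blocks P \<zeta> N) \<longrightarrow>
        (\<exists>l. N - lincomb r M l \<in> trivial_motions P) \<and>
        (\<forall>l. N - lincomb r M l \<in> trivial_motions P \<longrightarrow>
           (\<exists>i<r. l i \<noteq> 0) \<and> (\<forall>j<s. energy_form P r M (\<xi> j) l = 0))"
      using ex zero by blast
  qed
qed

end
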